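(* Let $G$ be a Polish group admitting an invariant metric. Then every $\mathcal M$-additive set in $G$ is transitively meager.
   Context: A Polish group is a topological group whose topology is separable and completely metrizable. An invariant metric is a metric compatible with the topology that is both left- and right-invariant. A set is meager if it is a countable union of nowhere dense sets. A set $X\subseteq G$ is $\mathcal M$-additive (meager-additive) if $MX=\{mx:m\in M,x\in X\}$ is meager for every meager set $M\subseteq G$. A set $S\subseteq G$ is transitively meager if for every perfect set $P\subseteq G$ (closed set without isolated points) there is a $\sigma$-compact set $F\supseteq S$ such that for all $x\in G$ the set $P\cap xF$ is meager in $P$ (in the subspace topology of $P$). *)

theory Defs
  imports "HOL-Analysis.Analysis" "HOL-Algebra.Coset"
begin

locale topological_group = group G
  for G :: "('a, 'b) monoid_scheme" (structure) and T :: "'a topology" +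
  assumes topspace_eq: "topspace T = carrier G"
    and continuous_mult: "continuous_map (prod_topology T T) T (\<lambda>(x, y). x \<otimes> y)"
    and continuous_inv: "continuous_map T T (\<lambda>x. inv x)"

locale Polish_group = topological_group G T
  for G :: "('a, 'b) monoid_scheme" (structure) and T :: "'a topology" +
  assumes separable: "separable_space T"
    and completely_metrizable: "completely_metrizable_space T"

text \<open>No completeness is required of the metric.\<close>

definition invariant_metric ::
    "('a, 'b) monoid_scheme \<Rightarrow> 'a topology \<Rightarrow> ('a \<Rightarrow> 'a \<Rightarrow> real) \<Rightarrow> bool" where
  "invariant_metric G T d \<longleftrightarrow>
     Metric_space (carrier G) d \<and>
     Metric_space.mtopology (carrier G) d = T \<and>
     (\<forall>x\<in>carrier G. \<forall>y\<in>carrier G. \<forall>z\<in>carrier G.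
        d (z \<otimes>\<^bsub>G\<^esub> x) (z \<otimes>\<^bsub>G\<^esub> y) = d x y \<and>
        d (x \<otimes>\<^bsub>G\<^esub> z) (y \<otimes>\<^bsub>G\<^esub> z) = d x y)"

definition nowhere_dense_in :: "'a topology \<Rightarrow> 'a set \<Rightarrow> bool" where
  "nowhere_dense_in X S \<longleftrightarrow> S \<subseteq> topspace X \<and> X interior_of (X closure_of S) = {}"

definition meager_in :: "'a topology \<Rightarrow> 'a set \<Rightarrow> bool" where
  "meager_in X S \<longleftrightarrow> (countable union_of nowhere_dense_in X) S"

definition sigma_compact_in :: "'a topology \<Rightarrow> 'a set \<Rightarrow> bool" where
  "sigma_compact_in X S \<longleftrightarrow> (countable union_of compactin X) S"

text \<open>The empty set counts as perfect.\<close>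

definition perfect_in :: "'a topology \<Rightarrow> 'a set \<Rightarrow> bool" where
  "perfect_in X P \<longleftrightarrow> closedin X P \<and> P \<subseteq> X derived_set_of P"

definition meager_additive ::
    "('a, 'b) monoid_scheme \<Rightarrow> 'a topology \<Rightarrow> 'a set \<Rightarrow> bool" where
  "meager_additive G T X \<longleftrightarrow>
     X \<subseteq> carrier G \<and> (\<forall>M. meager_in T M \<longrightarrow> meager_in T (M <#>\<^bsub>G\<^esub> X))"

definition transitively_meager ::
    "('a, 'b) monoid_scheme \<Rightarrow> 'a topology \<Rightarrow> 'a set \<Rightarrow> bool" where
  "transitively_meager G T S \<longleftrightarrow>
     S \<subseteq> carrier G \<and>
     (\<forall>P. perfect_in T P \<longrightarrow>
        (\<exists>F. sigma_compact_in T F \<and> S \<subseteq> F \<and>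
             (\<forall>x\<in>carrier G. meager_in (subtopology T P) (P \<inter> (x <#\<^bsub>G\<^esub> F)))))"

end

theory Submission
  imports Defs
begin

text \<open>
  Let \<open>d\<close> be an invariant metric and \<open>P\<close> a nonempty perfect set. One nowhere dense set, built to fit
  \<open>P\<close>, is enough: the \<open>\<sigma>\<close>-compact set \<open>F\<close> is read off from the fact that the product of its closure
  with \<open>X\<close> is meager.

  Choose finite sets \<open>L 0 \<subseteq> L 1 \<subseteq> \<dots>\<close> with union dense in \<open>P\<close>, and scales \<open>\<epsilon> n\<close>, \<open>\<rho> n\<close>, such that every
  point of \<open>L n\<close> has a partner in \<open>L (n + 1)\<close> at a distance between \<open>16 * \<epsilon> n\<close> and \<open>\<rho> n\<close>, and
  \<open>\<rho> (n + 1)\<close> is tiny compared with \<open>\<epsilon> n\<close>. Let \<open>q\<close> be a dense sequence in the group, and let \<open>avoiding\<close>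
  be the set of points whose distance from \<open>q n\<close> exceeds \<open>\<epsilon> n\<close>, for all \<open>n\<close>, by a factor bounded away
  from 1. It is nowhere dense, and so is its closure \<open>A\<close>. Hence \<open>A X\<close> is covered by countably many
  nowhere dense sets \<open>Z\<close>. For \<open>x \<in> X\<close>, the Baire category theorem in \<open>A\<close> yields a basic open set \<open>V\<close>
  that meets \<open>avoiding\<close> and some \<open>Z\<close> with \<open>(V \<inter> avoiding) x\<close> inside the closure of \<open>Z\<close>. For fixed \<open>V\<close>
  and \<open>Z\<close> the set \<open>E\<close> of all such \<open>x\<close> is closed, and \<open>F\<close> is the union of these countably many sets.

  Why is \<open>E\<close> small? Because \<open>(V \<inter> avoiding) E\<close> is nowhere dense, whereas it would be dense in some ball
  if, for all \<open>y\<close> in that ball and all \<open>n\<close>, there were an \<open>e \<in> E\<close> for which \<open>y e\<^sup>-\<^sup>1\<close> is close to a fixed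
  point of \<open>avoiding\<close> and keeps its distance from \<open>q j\<close> for all \<open>j < n\<close>; the remaining \<open>q j\<close> are then
  avoided by a tiny correction (\<open>ball_subset_closure_avoiding_mult\<close>). Two kinds of sets \<open>E\<close> offer such a
  choice of \<open>e\<close>.

  \<^item> Suppose that a translate of \<open>E\<close> contains a nonempty relatively open part of \<open>P\<close>. Walk through the sets
    \<open>L j\<close>: of a point and its partner at least one is \<open>8 * \<epsilon> j\<close> away from the point forbidden at stage
    \<open>j\<close>, and later moves are too short to spoil this (\<open>branches_escape_translate\<close>). So this does not
    happen, and \<open>P \<inter> x E\<close> is nowhere dense in \<open>P\<close> for every \<open>x\<close>.
  \<^item> Suppose that small pieces of \<open>E\<close> are not totally bounded. Then one piece of radius comparable to
    \<open>\<epsilon> k\<close> contains arbitrarily large finite sets that are separated at the scale \<open>\<epsilon> (k + 1)\<close>; each later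
    \<open>q j\<close> rules out at most one element (\<open>uniformly_locally_totally_bounded\<close>). So this does not happen
    either, and since an invariant metric of a Polish group is complete
    (\<open>mcomplete_if_completely_metrizable\<close>), \<open>E\<close> is a countable union of compact sets.

  For \<open>P = {}\<close> only a \<open>\<sigma>\<close>-compact superset of \<open>X\<close> is wanted. The whole group serves as a perfect set
  unless it has an isolated point, in which case it is countable.
\<close>

section \<open>Groups with an invariant metric\<close>

locale bi_invariant_group = group G + Metric_space "carrier G" d
  for G :: "('a, 'b) monoid_scheme" (structure) and d :: "'a \<Rightarrow> 'a \<Rightarrow> real" +
  assumes left_invariant:
      "\<lbrakk>x \<in> carrier G; y \<in> carrier G; z \<in> carrier G\<rbrakk> \<Longrightarrow> d (z \<otimes> x) (z \<otimes> y) = d x y"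
    and right_invariant:
      "\<lbrakk>x \<in> carrier G; y \<in> carrier G; z \<in> carrier G\<rbrakk> \<Longrightarrow> d (x \<otimes> z) (y \<otimes> z) = d x y"
begin

lemma dist_mult_inv:
  assumes "y \<in> carrier G" "e \<in> carrier G" "v \<in> carrier G"
  shows "d (y \<otimes> inv e) v = d y (v \<otimes> e)"
  using right_invariant[of "y \<otimes> inv e" v e] assms by (simp add: m_assoc)

lemma dist_left_mult:
  assumes "x \<in> carrier G" "y \<in> carrier G" "v \<in> carrier G"
  shows "d (x \<otimes> y) v = d y (inv x \<otimes> v)"
  using left_invariant[of y "inv x \<otimes> v" x] assms by (simp add: m_assoc[symmetric])

lemma dist_right_quotient:
  assumes "y \<in> carrier G" "e \<in> carrier G" "e' \<in> carrier G"
  shows "d (y \<otimes> inv e) (y \<otimes> inv e') = d e e'"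
proof -
  have "d (y \<otimes> inv e) (y \<otimes> inv e') = d y (y \<otimes> inv e' \<otimes> e)"
    using assms by (simp add: dist_mult_inv)
  also have "\<dots> = d (y \<otimes> \<one>) (y \<otimes> (inv e' \<otimes> e))"
    using assms by (simp add: m_assoc)
  also have "\<dots> = d (inv e' \<otimes> e) \<one>"
    using assms by (subst left_invariant) (auto simp: commute)
  also have "\<dots> = d e e'"
    using assms by (simp add: dist_left_mult)
  finally show ?thesis .
qed

lemma continuous_map_right_mult:
  assumes "x \<in> carrier G"
  shows "continuous_map mtopology mtopology (\<lambda>z. z \<otimes> x)"
  unfolding metric_continuous_map[OF Metric_space_axioms]
  using assms by (auto simp: right_invariant)

lemma continuous_map_left_mult:
  assumes "x \<in> carrier G"
  shows "continuous_map mtopology mtopology (\<lambda>z. x \<otimes> z)"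
  unfolding metric_continuous_map[OF Metric_space_axioms]
  using assms by (auto simp: left_invariant)

text \<open>
  Given a Cauchy sequence \<open>x\<close>, it is enough to find one \<open>g\<close> for which \<open>x k \<otimes> g\<close> converges. Let \<open>D\<close> be a
  complete metric of the topology. The \<open>g\<close> near which the tails of \<open>x k \<otimes> g\<close> stay in a \<open>D\<close>-ball of radius
  \<open>1 / (n + 1)\<close> form an open dense set, so by Baire some \<open>g\<close> makes the sequence \<open>x k \<otimes> g\<close> Cauchy for \<open>D\<close>.
  (In the completion: the comeager set \<open>G\<close> meets its translate by the limit of \<open>x\<close>.)
\<close>

lemma mcomplete_if_completely_metrizable:
  assumes "completely_metrizable_space mtopology"
  shows mcomplete
proof -
  obtain M D where D: "Metric_space M D" "Metric_space.mcomplete M D"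
    and top: "mtopology = Metric_space.mtopology M D"
    using assms unfolding completely_metrizable_space_def by blast
  interpret D: Metric_space M D by (rule D)
  have M: "M = carrier G"
    using top D.topspace_mtopology topspace_mtopology by metis
  show ?thesis
    unfolding mcomplete_def
  proof (intro allI impI)
    fix x assume x: "MCauchy x"
    then have xin: "x n \<in> carrier G" for n
      by (auto simp: MCauchy_def)
    define O' where "O' n = {g \<in> carrier G. \<exists>t>0. \<exists>m. \<exists>v \<in> carrier G.
      \<forall>k\<ge>m. \<forall>h \<in> mball g t. x k \<otimes> h \<in> D.mball v (1 / (Suc n))}" for n :: nat
    have O'I: "g \<in> O' n" if "g \<in> carrier G" "t > 0" "v \<in> carrier G"
      "\<And>k h. \<lbrakk>m \<le> k; h \<in> mball g t\<rbrakk> \<Longrightarrow> x k \<otimes> h \<in> D.mball v (1 / (Suc n))" for g n t m v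
      unfolding O'_def using that by blast
    have op: "openin mtopology (O' n)" for n
      unfolding openin_mtopology
    proof (intro conjI allI impI)
      show "O' n \<subseteq> carrier G" by (auto simp: O'_def)
      fix g assume "g \<in> O' n"
      then obtain t m v where g: "g \<in> carrier G" "t > 0" "v \<in> carrier G"
        and k: "\<forall>k\<ge>m. \<forall>h \<in> mball g t. x k \<otimes> h \<in> D.mball v (1 / (Suc n))"
        unfolding O'_def by blast
      have "g' \<in> O' n" if g': "g' \<in> mball g (t/2)" for g'
      proof -
        have "mball g' (t/2) \<subseteq> mball g t"
          using g' mball_subset[of g' g "t/2" t] g by (auto simp: commute)
        then show ?thesis
          using g g' k by (intro O'I[of g' "t/2" v m]) auto
      qed
      then have "mball g (t/2) \<subseteq> O' n" by blast
      then show "\<exists>r>0. mball g r \<subseteq> O' n" using g by (meson half_gt_zero)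
    qed
    have dense: "mtopology closure_of (O' n) = topspace mtopology" for n
    proof -
      have "\<exists>g'\<in>O' n. g' \<in> mball g s" if g: "g \<in> carrier G" "s > 0" for g s
      proof -
        obtain m where m: "\<And>k k'. \<lbrakk>m \<le> k; m \<le> k'\<rbrakk> \<Longrightarrow> d (x k) (x k') < s"
          using x g unfolding MCauchy_def by blast
        \<comment> \<open>Moving \<open>g\<close> to the point \<open>g'\<close> with \<open>x N \<otimes> g' = x m \<otimes> g\<close> costs only \<open>d (x N) (x m)\<close>, and it lets the
          tail start at an \<open>N\<close> that depends on the ball around \<open>x m \<otimes> g\<close>.\<close>
        define v where "v = x m \<otimes> g"
        have v: "v \<in> carrier G" using g xin by (simp add: v_def)
        have "openin mtopology (D.mball v (1 / (Suc n)))" "v \<in> D.mball v (1 / (Suc n))"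
          using v M D.openin_mball D.centre_in_mball_iff unfolding top by (blast, simp)
        then obtain t where t: "t > 0" "mball v t \<subseteq> D.mball v (1 / (Suc n))"
          by (meson openin_mtopology)
        obtain m' where m': "\<And>k k'. \<lbrakk>m' \<le> k; m' \<le> k'\<rbrakk> \<Longrightarrow> d (x k) (x k') < t/2"
          using x t unfolding MCauchy_def by (meson half_gt_zero)
        define N where "N = max m m'"
        define g' where "g' = inv (x N) \<otimes> v"
        have g': "g' \<in> carrier G" using v xin by (simp add: g'_def)
        have xg': "x N \<otimes> g' = v" using v xin by (simp add: g'_def m_assoc[symmetric])
        have "d g g' = d (x N \<otimes> g) (x N \<otimes> g')"
          using g g' xin by (simp add: left_invariant)
        also have "\<dots> = d (x N) (x m)"
          using g xin by (simp add: xg') (simp add: v_def right_invariant)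
        also have "\<dots> < s" using m by (simp add: N_def)
        finally have near: "g' \<in> mball g s" using g g' by simp
        have "x k \<otimes> h \<in> D.mball v (1 / (Suc n))" if k: "N \<le> k" and h: "h \<in> mball g' (t/2)" for k h
        proof -
          have hc: "h \<in> carrier G" using h by auto
          have "d (x k \<otimes> h) v \<le> d (x k \<otimes> h) (x N \<otimes> h) + d (x N \<otimes> h) (x N \<otimes> g')"
            using triangle[of "x k \<otimes> h" "x N \<otimes> h" v] hc xin v by (simp add: xg')
          also have "\<dots> = d (x k) (x N) + d h g'"
            using hc xin g' by (simp add: left_invariant right_invariant)
          also have "\<dots> < t"
            using m'[of k N] k h by (auto simp: N_def commute)
          finally have "x k \<otimes> h \<in> mball v t"
            using hc xin v by (simp add: commute)
          then show ?thesis using t by blast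
        qed
        then have "g' \<in> O' n"
          using g' v t by (intro O'I[of g' "t/2" v N]) auto
        then show ?thesis using near by blast
      qed
      then show ?thesis by (auto simp: metric_closure_of)
    qed
    have "mtopology closure_of \<Inter>(range O') = topspace mtopology"
      by (rule Baire_category) (use assms op dense in auto)
    moreover have "topspace mtopology \<noteq> {}" using xin by auto
    ultimately have "\<Inter>(range O') \<noteq> {}" by fastforce
    then obtain g where g: "\<And>n. g \<in> O' n" by blast
    then have gc: "g \<in> carrier G" by (auto simp: O'_def)
    have "D.MCauchy (\<lambda>k. x k \<otimes> g)"
      unfolding D.MCauchy_def
    proof (intro conjI allI impI)
      show "range (\<lambda>k. x k \<otimes> g) \<subseteq> M" using xin gc M by auto
      fix e :: real assume "e > 0"
      then obtain n where n: "1 / Suc n < e/2"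
        by (metis half_gt_zero nat_approx_posE of_nat_Suc)
      obtain t m v where "t > 0" "v \<in> carrier G"
        and k: "\<forall>k\<ge>m. \<forall>h \<in> mball g t. x k \<otimes> h \<in> D.mball v (1 / (Suc n))"
        using g[of n] unfolding O'_def by blast
      then have *: "x k \<otimes> g \<in> D.mball v (1 / (Suc n))" if "k \<ge> m" for k
        using gc that by auto
      have "D (x k \<otimes> g) (x k' \<otimes> g) < e" if "m \<le> k" "m \<le> k'" for k k'
        using *[OF that(1)] *[OF that(2)] n D.triangle[of "x k \<otimes> g" v "x k' \<otimes> g"]
        by (auto simp: D.commute)
      then show "\<exists>N. \<forall>n n'. N \<le> n \<longrightarrow> N \<le> n' \<longrightarrow> D (x n \<otimes> g) (x n' \<otimes> g) < e" by blast
    qed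
    then obtain l where l: "limitin mtopology (\<lambda>k. x k \<otimes> g) l sequentially"
      using D(2) unfolding D.mcomplete_def top by blast
    then have lc: "l \<in> carrier G" using limitin_topspace by force
    have "d (x k) (l \<otimes> inv g) = d (x k \<otimes> g) l" for k
      using lc gc xin by (metis dist_mult_inv commute m_closed inv_closed)
    then have "limitin mtopology x (l \<otimes> inv g) sequentially"
      using l lc gc xin unfolding limit_metric_sequentially by simp
    then show "\<exists>x'. limitin mtopology x x' sequentially" by blast
  qed
qed

lemma ball_subset_closure_not_nowhere_dense:
  assumes "u \<in> carrier G" "s > 0" "mball u s \<subseteq> mtopology closure_of S"
  shows "\<not> nowhere_dense_in mtopology S"
  using assms in_interior_of_mball unfolding nowhere_dense_in_def by blast

end

section \<open>Finite covers, basic balls and nowhere dense sets\<close>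

context Metric_space
begin

text \<open>
  This is total boundedness at a single scale; the argument below needs the scale at which it first fails.
\<close>

definition finitely_coverable :: "'a set \<Rightarrow> real \<Rightarrow> bool" where
  "finitely_coverable S \<theta> \<longleftrightarrow> (\<exists>K. finite K \<and> K \<subseteq> S \<and> S \<subseteq> (\<Union>x\<in>K. mball x \<theta>))"

lemma large_separated_subset:
  assumes "S \<subseteq> M" "\<theta> > 0" "\<not> finitely_coverable S \<theta>"
  shows "\<exists>T \<subseteq> S. finite T \<and> card T = n \<and> (\<forall>x\<in>T. \<forall>y\<in>T. x \<noteq> y \<longrightarrow> \<theta> \<le> d x y)"
proof (induction n)
  case 0
  show ?case by (intro exI[of _ "{}"]) auto
next
  case (Suc n)
  then obtain T where T: "T \<subseteq> S" "finite T" "card T = n"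
    "\<forall>x\<in>T. \<forall>y\<in>T. x \<noteq> y \<longrightarrow> \<theta> \<le> d x y" by blast
  have "\<not> S \<subseteq> (\<Union>x\<in>T. mball x \<theta>)"
    using assms(3) T(1,2) unfolding finitely_coverable_def by simp
  then obtain z where z: "z \<in> S" "z \<notin> (\<Union>x\<in>T. mball x \<theta>)"
    by (meson subsetI)
  then have far: "\<theta> \<le> d x z" if "x \<in> T" for x
    using that T assms by (auto simp: not_less)
  have "z \<notin> T"
    using far[of z] z assms by auto
  have "\<theta> \<le> d x y" if "x \<in> insert z T" "y \<in> insert z T" "x \<noteq> y" for x y
    using that far T(4) commute by (metis insert_iff)
  then show ?case
    using T(1-3) z(1) \<open>z \<notin> T\<close>
    by (intro exI[of _ "insert z T"] conjI ballI impI) (simp_all)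
qed

end

context Metric_space
begin

lemma small_rational_ball:
  assumes q: "\<And>n. q n \<in> M" "\<And>y r. \<lbrakk>y \<in> M; r > 0\<rbrakk> \<Longrightarrow> \<exists>i. d y (q i) < r"
    and W: "openin mtopology W" "b \<in> W"
  shows "\<exists>i k. b \<in> mball (q i) (1 / Suc k) \<and> mball (q i) (1 / Suc k) \<subseteq> W"
proof -
  obtain t where t: "t > 0" "mball b t \<subseteq> W"
    using W by (meson openin_mtopology)
  have b: "b \<in> M" using W openin_subset by fastforce
  obtain k where k: "1 / Suc k < t / 2"
    using nat_approx_posE[of "t / 2"] t by (metis half_gt_zero of_nat_Suc)
  obtain i where i: "d b (q i) < 1 / Suc k"
    using q(2)[OF b, of "1 / Suc k"] by auto
  have "mball (q i) (1 / Suc k) \<subseteq> mball b t"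
    using i k b q(1) by (intro mball_subset) (auto simp: commute)
  moreover have "b \<in> mball (q i) (1 / Suc k)"
    using i b q(1) by (simp add: commute)
  ultimately show ?thesis using t by blast
qed

end

lemma interior_of_subtopology_nonempty:
  assumes "(subtopology X S) interior_of R \<noteq> {}"
  obtains W where "openin X W" "W \<inter> S \<noteq> {}" "W \<inter> S \<subseteq> R"
proof -
  obtain W where "openin X W" "(subtopology X S) interior_of R = W \<inter> S"
    using openin_interior_of[of "subtopology X S" R] unfolding openin_subtopology by blast
  then show thesis
    using that[of W] assms interior_of_subset[of "subtopology X S" R] by simp
qed

lemma nowhere_dense_in_subset:
  assumes "nowhere_dense_in X S" "R \<subseteq> X closure_of S"
  shows "nowhere_dense_in X R"
proof -
  have "X closure_of R \<subseteq> X closure_of S"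
    using assms(2) by (simp add: closure_of_minimal)
  then show ?thesis
    using assms interior_of_mono[of "X closure_of R" "X closure_of S" X] closure_of_subset_topspace[of X S]
    unfolding nowhere_dense_in_def by blast
qed

section \<open>Scales at which a perfect set branches\<close>

text \<open>
  The constants leave room for the following. At stage \<open>n\<close> a walk through the sets \<open>L n\<close> gets \<open>8 * \<epsilon> n\<close>
  away from a forbidden point (half of 16) and at most \<open>2 * \<rho> (n + 1) \<le> \<epsilon> n\<close> is lost later, so \<open>7 * \<epsilon> n\<close>
  remain. After subtracting 5 for a ball of radius \<open>4 * \<epsilon> n\<close> moved by \<open>\<epsilon> n\<close>, this is still at least
  \<open>2 * \<epsilon> n\<close>. The power of 2 makes the ratio of \<open>\<rho> (n + 1)\<close> to \<open>\<epsilon> n\<close> tend to 0.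
\<close>

locale branching_scales = bi_invariant_group G d
  for G :: "('a, 'b) monoid_scheme" (structure) and d :: "'a \<Rightarrow> 'a \<Rightarrow> real" +
  fixes L :: "nat \<Rightarrow> 'a set" and \<epsilon> \<rho> :: "nat \<Rightarrow> real" and q :: "nat \<Rightarrow> 'a"
  assumes complete: mcomplete
    and L_carrier: "L n \<subseteq> carrier G"
    and L_nonempty: "L n \<noteq> {}"
    and L_Suc: "L n \<subseteq> L (Suc n)"
    and branch: "c \<in> L n \<Longrightarrow> \<exists>c' \<in> L (Suc n). 16 * \<epsilon> n \<le> d c c' \<and> d c c' \<le> \<rho> n"
    and \<epsilon>_pos: "\<epsilon> n > 0"
    and \<epsilon>_\<rho>: "16 * \<epsilon> n \<le> \<rho> n"
    and \<rho>_Suc: "2 ^ Suc n * \<rho> (Suc n) \<le> \<epsilon> n"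
    and q_carrier: "q n \<in> carrier G"
    and q_dense: "\<lbrakk>y \<in> carrier G; r > 0\<rbrakk> \<Longrightarrow> \<exists>i. d y (q i) < r"
begin

lemma \<rho>_pos: "\<rho> n > 0"
  using \<epsilon>_pos[of n] \<epsilon>_\<rho>[of n] by linarith

lemma two_\<rho>_Suc: "2 * \<rho> (Suc n) \<le> \<epsilon> n"
proof -
  have "2 * \<rho> (Suc n) \<le> 2 ^ Suc n * \<rho> (Suc n)"
    using \<rho>_pos[of "Suc n"] by (simp add: mult_le_cancel_right)
  then show ?thesis using \<rho>_Suc[of n] by linarith
qed

lemma \<epsilon>_decreasing: "m \<le> n \<Longrightarrow> \<epsilon> n \<le> \<epsilon> m"
  using lift_Suc_antimono_le[of \<epsilon> m n] two_\<rho>_Suc \<epsilon>_\<rho> \<epsilon>_pos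
  by (smt (verit))

lemma L_mono: "m \<le> n \<Longrightarrow> L m \<subseteq> L n"
  using lift_Suc_mono_le[of L m n] L_Suc by blast

text \<open>
  Moves at a late scale are small not only absolutely but also relative to every earlier \<open>\<epsilon> j\<close>; so they
  change the factor by which the earlier points are avoided arbitrarily little.
\<close>

lemma eventually_scale_small:
  assumes "\<gamma> > 0"
  shows "\<exists>m0. \<forall>m\<ge>m0. \<rho> m \<le> \<gamma> \<and> (\<forall>j<m. \<rho> m \<le> \<gamma> * \<epsilon> j)"
proof -
  define \<delta> where "\<delta> = min \<gamma> (\<gamma> / \<epsilon> 0)"
  have "\<delta> > 0" using assms \<epsilon>_pos by (simp add: \<delta>_def)
  then obtain N where N: "(1/2 :: real) ^ N < \<delta>"
    using real_arch_pow_inv[of \<delta> "1/2"] by auto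
  have "\<rho> m \<le> \<gamma> \<and> (\<forall>j<m. \<rho> m \<le> \<gamma> * \<epsilon> j)" if "Suc N \<le> m" for m
  proof -
    define k where "k = m - 1"
    have k: "m = Suc k" "N \<le> k" using that by (auto simp: k_def)
    have "(1/2 :: real) ^ Suc k \<le> (1/2) ^ N"
      using k by (intro power_decreasing) auto
    then have small: "(1/2 :: real) ^ Suc k \<le> \<delta>" using N by linarith
    have "\<rho> m = (1/2) ^ Suc k * (2 ^ Suc k * \<rho> (Suc k))"
      by (simp add: k power_divide)
    also have "\<dots> \<le> (1/2) ^ Suc k * \<epsilon> k"
      by (intro mult_left_mono \<rho>_Suc) auto
    also have "\<dots> \<le> \<delta> * \<epsilon> k"
      using small \<epsilon>_pos[of k] by (intro mult_right_mono) auto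
    finally have le: "\<rho> m \<le> \<delta> * \<epsilon> k" .
    have "\<delta> * \<epsilon> k \<le> (\<gamma> / \<epsilon> 0) * \<epsilon> 0"
      using \<epsilon>_decreasing[of 0 k] \<epsilon>_pos[of k] \<epsilon>_pos[of 0] assms
      by (intro mult_mono) (auto simp: \<delta>_def)
    then have "\<rho> m \<le> \<gamma>" using le \<epsilon>_pos[of 0] by simp
    moreover have "\<rho> m \<le> \<gamma> * \<epsilon> j" if "j < m" for j
    proof -
      have "\<delta> * \<epsilon> k \<le> \<gamma> * \<epsilon> j"
        using that k \<epsilon>_decreasing[of j k] \<epsilon>_pos[of k] assms
        by (intro mult_mono) (auto simp: \<delta>_def)
      then show ?thesis using le by linarith
    qed
    ultimately show ?thesis by blast
  qed
  then show ?thesis by blast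
qed

section \<open>Walks that keep away from forbidden points\<close>

text \<open>
  At stage \<open>n\<close> the walk stays where it is if it is far enough from \<open>a n\<close>, and moves to the partner otherwise;
  both cannot be within \<open>8 * \<epsilon> n\<close> of \<open>a n\<close>. The forbidden points \<open>a j\<close> are arbitrary: they will be
  translates of the points \<open>q j\<close> that depend on the target \<open>y\<close>.
\<close>

lemma avoiding_walk:
  assumes a: "\<And>j. a j \<in> carrier G" and c: "c \<in> L m"
  obtains w where "w m = c" "\<And>n. m \<le> n \<Longrightarrow> w n \<in> L n"
    "\<And>i n. \<lbrakk>m \<le> i; i \<le> n\<rbrakk> \<Longrightarrow> d (w i) (w n) \<le> 2 * \<rho> i"
    "\<And>j n. \<lbrakk>m \<le> j; j < n\<rbrakk> \<Longrightarrow> 7 * \<epsilon> j \<le> d (w n) (a j)"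
proof -
  have step: "\<exists>y \<in> L (Suc n). d x y \<le> \<rho> n \<and> 8 * \<epsilon> n \<le> d y (a n)" if x: "x \<in> L n" for n x
  proof (cases "8 * \<epsilon> n \<le> d x (a n)")
    case True
    have "x \<in> L (Suc n)" using x L_Suc by blast
    moreover have "d x x \<le> \<rho> n" using x L_carrier \<rho>_pos[of n] by (simp add: subset_iff less_imp_le)
    ultimately show ?thesis using True by blast
  next
    case False
    obtain y where y: "y \<in> L (Suc n)" "16 * \<epsilon> n \<le> d x y" "d x y \<le> \<rho> n"
      using branch[OF x] by blast
    have "d x y \<le> d x (a n) + d (a n) y"
      using triangle x y a L_carrier by blast
    then have "8 * \<epsilon> n \<le> d y (a n)"
      using False y by (simp add: commute)
    then show ?thesis using y by blast
  qed
  obtain f where f: "\<And>n. f n \<in> L (m + n) \<and> (n = 0 \<longrightarrow> f n = c)"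
    and fS: "\<And>n. d (f n) (f (Suc n)) \<le> \<rho> (m + n) \<and> 8 * \<epsilon> (m + n) \<le> d (f (Suc n)) (a (m + n))"
  proof -
    have "\<exists>f. \<forall>n. (f n \<in> L (m + n) \<and> (n = 0 \<longrightarrow> f n = c))
      \<and> (d (f n) (f (Suc n)) \<le> \<rho> (m + n) \<and> 8 * \<epsilon> (m + n) \<le> d (f (Suc n)) (a (m + n)))"
    proof (rule dependent_nat_choice)
      show "\<exists>x. x \<in> L (m + 0) \<and> (0 = (0::nat) \<longrightarrow> x = c)" using c by auto
      fix x n assume "x \<in> L (m + n) \<and> (n = 0 \<longrightarrow> x = c)"
      then show "\<exists>y. (y \<in> L (m + Suc n) \<and> (Suc n = 0 \<longrightarrow> y = c))
        \<and> d x y \<le> \<rho> (m + n) \<and> 8 * \<epsilon> (m + n) \<le> d y (a (m + n))"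
        using step[of x "m + n"] by auto
    qed
    then show ?thesis using that by blast
  qed
  define w where "w n = f (n - m)" for n
  have wL: "w n \<in> L n" if "m \<le> n" for n
    using f[of "n - m"] that by (simp add: w_def)
  then have wc: "w n \<in> carrier G" if "m \<le> n" for n
    using L_carrier that by blast
  have wS: "d (w n) (w (Suc n)) \<le> \<rho> n" "8 * \<epsilon> n \<le> d (w (Suc n)) (a n)" if "m \<le> n" for n
    using fS[of "n - m"] that by (simp_all add: w_def Suc_diff_le)
  have tail: "d (w i) (w (i + k)) \<le> 2 * \<rho> i - 2 * \<rho> (i + k)" if i: "m \<le> i" for i k
  proof (induction k)
    case 0
    show ?case using wc[OF i] by simp
  next
    case (Suc k)
    have "d (w i) (w (i + Suc k)) \<le> d (w i) (w (i + k)) + d (w (i + k)) (w (Suc (i + k)))"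
      using triangle[of "w i" "w (i + k)" "w (Suc (i + k))"] wc i by simp
    also have "\<dots> \<le> 2 * \<rho> i - 2 * \<rho> (i + k) + \<rho> (i + k)"
      using Suc wS(1)[of "i + k"] i by simp
    also have "\<dots> \<le> 2 * \<rho> i - 2 * \<rho> (i + Suc k)"
      using two_\<rho>_Suc[of "i + k"] \<epsilon>_\<rho>[of "i + k"] \<epsilon>_pos[of "i + k"] by simp
    finally show ?case .
  qed
  have near: "d (w i) (w n) \<le> 2 * \<rho> i" if "m \<le> i" "i \<le> n" for i n
    using tail[of i "n - i"] \<rho>_pos[of n] that by simp
  have far: "7 * \<epsilon> j \<le> d (w n) (a j)" if "m \<le> j" "j < n" for j n
  proof -
    have "d (w (Suc j)) (a j) \<le> d (w (Suc j)) (w n) + d (w n) (a j)"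
      using triangle wc a that by simp
    then show ?thesis
      using near[of "Suc j" n] wS(2)[of j] two_\<rho>_Suc[of j] that by simp
  qed
  have "w m = c" using f[of 0] by (simp add: w_def)
  then show ?thesis using that[of w] wL near far by simp
qed

text \<open>
  By left invariance the displacements of a walk can be applied to any starting point \<open>v\<close>. The limit of the
  walk avoids all the points \<open>q j\<close> with \<open>j \<ge> m\<close> at once.
\<close>

lemma avoiding_point:
  assumes v: "v \<in> carrier G" 
  shows "\<exists>z\<in>carrier G. d v z \<le> 2 * \<rho> m \<and> (\<forall>j\<ge>m. 7 * \<epsilon> j \<le> d z (q j))"
proof -
  obtain c where c: "c \<in> L m" using L_nonempty by blast
  then have cc: "c \<in> carrier G" using L_carrier by blast
  define a where "a j = c \<otimes> inv v \<otimes> q j" for j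
  have a: "a j \<in> carrier G" for j using cc v q_carrier by (simp add: a_def)
  obtain w where w: "w m = c" "\<And>n. m \<le> n \<Longrightarrow> w n \<in> L n"
    "\<And>i n. \<lbrakk>m \<le> i; i \<le> n\<rbrakk> \<Longrightarrow> d (w i) (w n) \<le> 2 * \<rho> i"
    "\<And>j n. \<lbrakk>m \<le> j; j < n\<rbrakk> \<Longrightarrow> 7 * \<epsilon> j \<le> d (w n) (a j)"
    by (rule avoiding_walk[of a, OF a c]) (rule that; (assumption | blast))
  define x where "x n = w (m + n)" for n
  have xc: "x n \<in> carrier G" for n
    using w(2)[of "m + n"] L_carrier[of "m + n"] by (auto simp: x_def)
  have "MCauchy x"
    unfolding MCauchy_def
  proof (intro conjI allI impI)
    show "range x \<subseteq> carrier G" using xc by auto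
    fix e :: real assume "e > 0"
    then obtain N where N: "\<And>n. n \<ge> N \<Longrightarrow> \<rho> n \<le> e / 8"
      using eventually_scale_small[of "e/8"] by auto
    have "d (x n) (x n') < e" if "N \<le> n" "N \<le> n'" for n n'
      using triangle[of "x n" "x N" "x n'"] xc w(3)[of "m + N" "m + n"] w(3)[of "m + N" "m + n'"]
        N[of "m + N"] that \<open>e > 0\<close>
      by (simp add: x_def commute)
    then show "\<exists>N. \<forall>n n'. N \<le> n \<longrightarrow> N \<le> n' \<longrightarrow> d (x n) (x n') < e" by blast
  qed
  then obtain l where l: "limitin mtopology x l sequentially"
    using complete unfolding mcomplete_def by blast
  then have lc: "l \<in> carrier G"
    and lim: "\<And>e. e > 0 \<Longrightarrow> \<exists>N. \<forall>n\<ge>N. d (x n) l < e"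
    unfolding limit_metric_sequentially by blast+
  have cl: "d c l \<le> 2 * \<rho> m"
  proof (rule field_le_epsilon)
    fix e :: real assume "e > 0"
    then obtain n where "d (x n) l < e" using lim by blast
    then show "d c l \<le> 2 * \<rho> m + e"
      using triangle[of c "x n" l] cc xc lc w(1) w(3)[of m "m + n"] by (simp add: x_def)
  qed
  have al: "7 * \<epsilon> j \<le> d l (a j)" if "m \<le> j" for j
  proof (rule field_le_epsilon)
    fix e :: real assume "e > 0"
    then obtain N where N: "\<And>n. n \<ge> N \<Longrightarrow> d (x n) l < e" using lim by blast
    define n where "n = max N (Suc j)"
    have "d (x n) l < e" "j < m + n" using N by (auto simp: n_def)
    then show "7 * \<epsilon> j \<le> d l (a j) + e"
      using triangle[of "x n" l "a j"] xc lc a w(4)[of j "m + n"] that by (simp add: x_def)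
  qed
  \<comment> \<open>Transport the walk, which starts at \<open>c\<close>, to \<open>v\<close> by a left translation.\<close>
  define z where "z = v \<otimes> inv c \<otimes> l"
  have z: "z \<in> carrier G" using v cc lc by (simp add: z_def)
  have "d z y = d l (c \<otimes> inv v \<otimes> y)" if "y \<in> carrier G" for y
    using dist_left_mult[of "v \<otimes> inv c" l y] that v cc lc
    by (simp add: z_def inv_mult_group)
  then have "d z v = d l c" "d z (q j) = d l (a j)" for j
    using v cc q_carrier by (simp_all add: a_def m_assoc)
  then show ?thesis using z cl al by (intro bexI[of _ z]) (auto simp: commute)
qed

section \<open>Smallness from a nowhere dense product\<close>

text \<open>
  The uniform factor \<open>\<sigma> > 1\<close> makes \<open>avoiding\<close> stable: a point that differs from one of its elements by a move
  at a late scale still avoids all the earlier \<open>q j\<close>, with a slightly smaller factor.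
\<close>

definition avoiding :: "'a set" where
  "avoiding = {z \<in> carrier G. \<exists>\<sigma>>1. \<forall>j. \<sigma> * \<epsilon> j \<le> d z (q j)}"

lemma avoiding_carrier: "avoiding \<subseteq> carrier G"
  by (auto simp: avoiding_def)

lemma avoiding_nonempty: "avoiding \<noteq> {}"
proof -
  obtain z where "z \<in> carrier G" "\<And>j. 7 * \<epsilon> j \<le> d z (q j)"
    using avoiding_point[OF one_closed, of 0] by auto
  then have "z \<in> avoiding"
    unfolding avoiding_def by (auto intro!: exI[of _ 7])
  then show ?thesis by blast
qed

lemma avoiding_nowhere_dense: "nowhere_dense_in mtopology avoiding"
  unfolding nowhere_dense_in_def
proof
  show "avoiding \<subseteq> topspace mtopology" by (simp add: avoiding_carrier)
  have False if z: "z \<in> carrier G" "e > 0" "mball z e \<subseteq> mtopology closure_of avoiding" for z e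
  proof -
    obtain i where "d z (q i) < e" using q_dense[OF z(1,2)] by blast
    then have "q i \<in> mtopology closure_of avoiding" using z q_carrier by auto
    then have "\<exists>y\<in>avoiding. y \<in> mball (q i) (\<epsilon> i)"
      using \<epsilon>_pos[of i] by (simp add: metric_closure_of)
    then obtain y where y: "y \<in> avoiding" "d (q i) y < \<epsilon> i" by auto
    then obtain \<sigma> where "\<sigma> > 1" "\<sigma> * \<epsilon> i \<le> d y (q i)"
      by (auto simp: avoiding_def)
    moreover have "1 * \<epsilon> i \<le> \<sigma> * \<epsilon> i"
      using \<epsilon>_pos[of i] \<open>\<sigma> > 1\<close> by (intro mult_right_mono) auto
    ultimately show False using y by (simp add: commute)
  qed
  then show "mtopology interior_of (mtopology closure_of avoiding) = {}"
    unfolding metric_interior_of by blast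
qed

text \<open>
  Choose \<open>e\<close> for a large \<open>n\<close> and correct \<open>y \<otimes> inv e\<close> by a move at scale \<open>n\<close> to a point \<open>z\<close> that avoids the
  points \<open>q j\<close> with \<open>j \<ge> n\<close> as well. Then \<open>z \<otimes> e\<close> lies in the product, and by right invariance it is as
  close to \<open>y\<close> as \<open>z\<close> is to \<open>y \<otimes> inv e\<close>.
\<close>

lemma ball_subset_closure_avoiding_mult:
  assumes b: "b \<in> carrier G" and r: "r > 0" and \<sigma>: "\<sigma> > 1" and E: "E \<subseteq> carrier G"
    and u: "u \<in> carrier G"
    and steer: "\<And>y n. y \<in> mball u s \<Longrightarrow>
      \<exists>e\<in>E. d (y \<otimes> inv e) b \<le> r / 2 \<and> (\<forall>j<n. \<sigma> * \<epsilon> j \<le> d (y \<otimes> inv e) (q j))"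
  shows "mball u s \<subseteq> mtopology closure_of ((avoiding \<inter> mball b r) <#> E)"
proof
  fix y assume y: "y \<in> mball u s"
  then have yc: "y \<in> carrier G" by simp
  have "\<exists>p \<in> (avoiding \<inter> mball b r) <#> E. p \<in> mball y t" if t: "t > 0" for t
  proof -
    define \<gamma> where "\<gamma> = min (t/3) (min (r/6) ((\<sigma> - 1) / 4))"
    have \<gamma>: "\<gamma> > 0" "\<gamma> \<le> t/3" "\<gamma> \<le> r/6" "\<gamma> \<le> (\<sigma> - 1) / 4"
      unfolding \<gamma>_def using t r \<sigma> by (simp, linarith+)
    obtain n where n: "\<rho> n \<le> \<gamma>" "\<And>j. j < n \<Longrightarrow> \<rho> n \<le> \<gamma> * \<epsilon> j"
      using eventually_scale_small[OF \<gamma>(1)] by blast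
    obtain e where e: "e \<in> E" "d (y \<otimes> inv e) b \<le> r / 2"
      "\<And>j. j < n \<Longrightarrow> \<sigma> * \<epsilon> j \<le> d (y \<otimes> inv e) (q j)"
      using steer[OF y, of n] by blast
    define v where "v = y \<otimes> inv e"
    have ec: "e \<in> carrier G" using e E by blast
    then have vc: "v \<in> carrier G" using yc by (simp add: v_def)
    obtain z where z: "z \<in> carrier G" "d v z \<le> 2 * \<rho> n" "\<And>j. n \<le> j \<Longrightarrow> 7 * \<epsilon> j \<le> d z (q j)"
      using avoiding_point[OF vc, of n] by blast
    \<comment> \<open>The correction may halve the excess of \<open>\<sigma>\<close> over 1.\<close>
    define \<tau> where "\<tau> = min 2 ((\<sigma> + 1) / 2)"
    have \<tau>_le: "\<tau> \<le> (\<sigma> + 1) / 2" unfolding \<tau>_def by (rule min.cobounded2)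
    have "\<tau> * \<epsilon> j \<le> d z (q j)" for j
    proof (cases "n \<le> j")
      case True
      have "\<tau> * \<epsilon> j \<le> 7 * \<epsilon> j"
        using \<epsilon>_pos[of j] by (intro mult_right_mono) (auto simp: \<tau>_def)
      then show ?thesis using z(3)[OF True] by linarith
    next
      case False
      have "\<tau> * \<epsilon> j \<le> (\<sigma> + 1) / 2 * \<epsilon> j" "\<gamma> * \<epsilon> j \<le> (\<sigma> - 1) / 4 * \<epsilon> j"
        using mult_right_mono[OF \<tau>_le less_imp_le[OF \<epsilon>_pos]]
          mult_right_mono[OF \<gamma>(4) less_imp_le[OF \<epsilon>_pos]] by blast+
      moreover have "d v (q j) \<le> d v z + d z (q j)"
        using triangle vc z q_carrier by blast
      ultimately show ?thesis
        using e(3)[of j] z(2) n(2)[of j] False by (simp add: v_def field_simps)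
    qed
    moreover have "\<tau> > 1" using \<sigma> by (simp add: \<tau>_def)
    ultimately have "z \<in> avoiding" using z(1) by (auto simp: avoiding_def)
    moreover have "d b z < r"
      using triangle[of b v z] b vc z(1,2) n(1) \<gamma> e(2) r by (simp add: v_def commute)
    ultimately have "z \<otimes> e \<in> (avoiding \<inter> mball b r) <#> E"
      using e(1) z(1) b by (auto simp: set_mult_def)
    moreover have "d y (z \<otimes> e) = d v z"
      using dist_mult_inv[OF yc ec z(1)] by (simp add: v_def)
    ultimately show ?thesis
      using z(1,2) ec yc n(1) \<gamma>(1,2) by (intro bexI[of _ "z \<otimes> e"]) auto
  qed
  then show "y \<in> mtopology closure_of ((avoiding \<inter> mball b r) <#> E)"
    using yc by (simp add: metric_closure_of)
qed

text \<open>
  If all points of the sets \<open>L n\<close> near \<open>c\<close> were in \<open>x <# E\<close>, then a walk from \<open>c\<close> would provide the elements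
  \<open>e\<close> demanded by \<open>ball_subset_closure_avoiding_mult\<close>: writing a position of the walk as \<open>x \<otimes> e\<close>, the
  distance of \<open>y \<otimes> inv e\<close> from \<open>q j\<close> is that of the position from \<open>x \<otimes> (inv (q j) \<otimes> y)\<close>.
\<close>

lemma branches_escape_translate:
  assumes b: "b \<in> avoiding" and r: "r > 0" and E: "E \<subseteq> carrier G"
    and nwd: "nowhere_dense_in mtopology ((avoiding \<inter> mball b r) <#> E)"
    and x: "x \<in> carrier G" and c: "c \<in> L i" and s: "s > 0"
  shows "\<exists>c' \<in> (\<Union>n. L n). d c c' < s \<and> c' \<notin> x <# E"
proof (rule ccontr)
  assume "\<not> ?thesis"
  then have trapped: "c' \<in> x <# E" if "c' \<in> L n" "d c c' < s" for c' n
    using that by blast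
  obtain \<sigma> where bc: "b \<in> carrier G" and \<sigma>: "\<sigma> > 1" "\<And>j. \<sigma> * \<epsilon> j \<le> d b (q j)"
    using b by (auto simp: avoiding_def)
  define \<gamma> where "\<gamma> = min (s/4) (min (r/8) ((\<sigma> - 1) / 6))"
  have \<gamma>: "\<gamma> > 0" "\<gamma> \<le> s/4" "\<gamma> \<le> r/8" "\<gamma> \<le> (\<sigma> - 1) / 6"
    unfolding \<gamma>_def using s r \<sigma>(1) by (simp, linarith+)
  obtain m0 where m0: "\<And>m. m \<ge> m0 \<Longrightarrow> \<rho> m \<le> \<gamma> \<and> (\<forall>j<m. \<rho> m \<le> \<gamma> * \<epsilon> j)"
    using eventually_scale_small[OF \<gamma>(1)] by blast
  define m where "m = max m0 i"
  have m: "\<rho> m \<le> \<gamma>" "\<And>j. j < m \<Longrightarrow> \<rho> m \<le> \<gamma> * \<epsilon> j"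
    using m0[of m] by (auto simp: m_def)
  have cm: "c \<in> L m" using c L_mono[of i m] by (auto simp: m_def)
  then have cc: "c \<in> carrier G" using L_carrier by blast
  define e0 where "e0 = inv x \<otimes> c"
  have e0: "e0 \<in> carrier G" "x \<otimes> e0 = c" using x cc by (auto simp: e0_def m_assoc[symmetric])
  have u: "b \<otimes> e0 \<in> carrier G" using bc e0 by simp
  define \<tau> where "\<tau> = min 2 ((\<sigma> + 1) / 2)"
  have \<tau>_le: "\<tau> \<le> (\<sigma> + 1) / 2" unfolding \<tau>_def by (rule min.cobounded2)
  have \<tau>: "\<tau> > 1" using \<sigma> by (simp add: \<tau>_def)
  have "mball (b \<otimes> e0) (\<rho> m) \<subseteq> mtopology closure_of ((avoiding \<inter> mball b r) <#> E)"
  proof (rule ball_subset_closure_avoiding_mult[OF bc r \<tau> E u])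
    fix y n assume y: "y \<in> mball (b \<otimes> e0) (\<rho> m)"
    then have yc: "y \<in> carrier G" by simp
    define a where "a j = x \<otimes> (inv (q j) \<otimes> y)" for j
    have a: "a j \<in> carrier G" for j using x yc q_carrier by (simp add: a_def)
    obtain w where w: "w m = c" "\<And>n. m \<le> n \<Longrightarrow> w n \<in> L n"
      "\<And>i n. \<lbrakk>m \<le> i; i \<le> n\<rbrakk> \<Longrightarrow> d (w i) (w n) \<le> 2 * \<rho> i"
      "\<And>j n. \<lbrakk>m \<le> j; j < n\<rbrakk> \<Longrightarrow> 7 * \<epsilon> j \<le> d (w n) (a j)"
      by (rule avoiding_walk[of a, OF a cm]) (rule that; (assumption | blast))
    define N where "N = max n m"
    have dN: "d c (w N) \<le> 2 * \<rho> m" using w(1) w(3)[of m N] by (simp add: N_def)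
    have "w N \<in> x <# E"
      using trapped[of "w N" N] w(2)[of N] dN m(1) \<gamma> by (simp add: N_def)
    then obtain e where e: "e \<in> E" "w N = x \<otimes> e" by (auto simp: l_coset_def)
    then have ec: "e \<in> carrier G" using E by blast
    define v where "v = y \<otimes> inv e"
    have vc: "v \<in> carrier G" using yc ec by (simp add: v_def)
    have "d v (q j) = d (w N) (a j)" for j
    proof -
      have "d v (q j) = d (q j \<otimes> e) y"
        unfolding v_def using yc ec q_carrier by (subst dist_mult_inv) (auto simp: commute)
      also have "\<dots> = d e (inv (q j) \<otimes> y)"
        using yc ec q_carrier by (simp add: dist_left_mult)
      also have "\<dots> = d (w N) (a j)"
        using yc ec q_carrier x by (simp add: a_def e(2) left_invariant)
      finally show ?thesis .
    qed
    then have new: "7 * \<epsilon> j \<le> d v (q j)" if "m \<le> j" "j < n" for j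
      using w(4)[of j N] that by (simp add: N_def)
    have "d e0 e = d c (w N)"
      using left_invariant[OF e0(1) ec x] by (simp add: e0(2) e(2))
    then have "d (b \<otimes> e0) (b \<otimes> e) \<le> 2 * \<rho> m"
      using dN left_invariant[OF e0(1) ec bc] by simp
    moreover have "d v b = d y (b \<otimes> e)"
      using yc ec bc by (simp add: v_def dist_mult_inv)
    moreover have "d y (b \<otimes> e) \<le> d y (b \<otimes> e0) + d (b \<otimes> e0) (b \<otimes> e)"
      using triangle yc ec bc e0(1) by simp
    ultimately have vb: "d v b \<le> 3 * \<rho> m"
      using y by (simp add: commute)
    have "\<tau> * \<epsilon> j \<le> d v (q j)" if "j < n" for j
    proof (cases "m \<le> j")
      case True
      have "\<tau> * \<epsilon> j \<le> 7 * \<epsilon> j"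
        using \<epsilon>_pos[of j] by (intro mult_right_mono) (auto simp: \<tau>_def)
      then show ?thesis using new[OF True that] by linarith
    next
      case False
      have "\<tau> * \<epsilon> j \<le> (\<sigma> + 1) / 2 * \<epsilon> j" "\<gamma> * \<epsilon> j \<le> (\<sigma> - 1) / 6 * \<epsilon> j"
        using mult_right_mono[OF \<tau>_le less_imp_le[OF \<epsilon>_pos]]
          mult_right_mono[OF \<gamma>(4) less_imp_le[OF \<epsilon>_pos]] by blast+
      moreover have "d b (q j) \<le> d b v + d v (q j)"
        using triangle vc bc q_carrier by blast
      ultimately show ?thesis
        using \<sigma>(2)[of j] vb m(2)[of j] False by (simp add: commute field_simps)
    qed
    moreover have "d v b \<le> r / 2" using vb m(1) \<gamma> by linarith
    ultimately show "\<exists>e\<in>E. d (y \<otimes> inv e) b \<le> r / 2 \<and> (\<forall>j<n. \<tau> * \<epsilon> j \<le> d (y \<otimes> inv e) (q j))"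
      using e(1) by (auto simp: v_def)
  qed
  then show False
    using ball_subset_closure_not_nowhere_dense[OF u \<rho>_pos] nwd by blast
qed

text \<open>
  If a piece of radius \<open>4 * \<epsilon> m\<close> is not totally bounded, there is a first \<open>k\<close> for which balls of radius
  \<open>4 * \<epsilon> (k + 1)\<close> no longer cover it finitely, and one ball of radius \<open>4 * \<epsilon> k\<close> contains arbitrarily large
  separated sets. For \<open>y\<close> close to \<open>z \<otimes> e\<close>, with \<open>e\<close> the centre of that ball and \<open>z\<close> an avoiding point near
  \<open>b\<close>, all candidates \<open>e'\<close> in the ball keep \<open>y \<otimes> inv e'\<close> within \<open>5 * \<epsilon> k\<close> of \<open>z\<close>, hence away from \<open>q j\<close> for
  \<open>j \<le> k\<close>. For \<open>j > k\<close> the separation makes the pigeonhole principle available.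
\<close>

lemma uniformly_locally_totally_bounded:
  assumes b: "b \<in> avoiding" and r: "r > 0" and E: "E \<subseteq> carrier G"
    and nwd: "nowhere_dense_in mtopology ((avoiding \<inter> mball b r) <#> E)"
  shows "\<exists>\<delta>>0. \<forall>e\<in>E. mtotally_bounded (E \<inter> mball e \<delta>)"
proof -
  obtain \<sigma> where bc: "b \<in> carrier G" and \<sigma>: "\<sigma> > 1" "\<And>j. \<sigma> * \<epsilon> j \<le> d b (q j)"
    using b by (auto simp: avoiding_def)
  define \<gamma> where "\<gamma> = min (r/8) ((\<sigma> - 1) / 6)"
  have \<gamma>: "\<gamma> > 0" "\<gamma> \<le> r/8" "\<gamma> \<le> (\<sigma> - 1) / 6"
    unfolding \<gamma>_def using r \<sigma>(1) by (simp, linarith+)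
  obtain m where m: "\<rho> m \<le> \<gamma>" "\<And>j. j < m \<Longrightarrow> \<rho> m \<le> \<gamma> * \<epsilon> j"
    using eventually_scale_small[OF \<gamma>(1)] by blast
  define \<tau> where "\<tau> = min 2 ((\<sigma> + 1) / 2)"
  have \<tau>_le: "\<tau> \<le> (\<sigma> + 1) / 2" unfolding \<tau>_def by (rule min.cobounded2)
  have \<tau>: "\<tau> > 1" "\<tau> \<le> 2" using \<sigma> by (auto simp: \<tau>_def)
  have "mtotally_bounded (E \<inter> mball e0 (4 * \<epsilon> m))" (is "mtotally_bounded ?S") if e0: "e0 \<in> E" for e0
  proof (rule ccontr)
    assume "\<not> mtotally_bounded ?S"
    then obtain \<theta> where \<theta>: "\<theta> > 0" "\<not> finitely_coverable ?S \<theta>"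
      unfolding mtotally_bounded_def finitely_coverable_def by blast
    have SE: "?S \<subseteq> E" "?S \<subseteq> carrier G" by auto
    have "e0 \<in> ?S" using e0 E \<epsilon>_pos[of m] by auto
    then have base: "finitely_coverable ?S (4 * \<epsilon> m)"
      unfolding finitely_coverable_def by (intro exI[of _ "{e0}"]) auto
    have "\<exists>k\<ge>m. finitely_coverable ?S (4 * \<epsilon> k) \<and> \<not> finitely_coverable ?S (4 * \<epsilon> (Suc k))"
    proof (rule ccontr)
      assume "\<not> ?thesis"
      then have *: "finitely_coverable ?S (4 * \<epsilon> (m + i))" for i
        using base by (induction i) auto
      obtain N where N: "\<And>n. n \<ge> N \<Longrightarrow> \<rho> n \<le> \<theta>"
        using eventually_scale_small[OF \<theta>(1)] by blast
      have "4 * \<epsilon> (m + N) \<le> \<theta>"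
        using N[of "m + N"] \<epsilon>_\<rho>[of "m + N"] \<epsilon>_pos[of "m + N"] by simp
      moreover obtain K where "finite K" "K \<subseteq> ?S" "?S \<subseteq> (\<Union>x\<in>K. mball x (4 * \<epsilon> (m + N)))"
        using *[of N] unfolding finitely_coverable_def by blast
      ultimately have "finitely_coverable ?S \<theta>"
        unfolding finitely_coverable_def
        by (meson UN_mono mball_subset_concentric order_refl order_trans)
      then show False using \<theta> by blast
    qed
    then obtain k where k: "m \<le> k" "finitely_coverable ?S (4 * \<epsilon> k)"
      "\<not> finitely_coverable ?S (4 * \<epsilon> (Suc k))" by blast
    then obtain K where K: "finite K" "K \<subseteq> ?S" "?S \<subseteq> (\<Union>x\<in>K. mball x (4 * \<epsilon> k))"
      unfolding finitely_coverable_def by blast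
    have "\<exists>e\<in>K. \<not> finitely_coverable (?S \<inter> mball e (4 * \<epsilon> k)) (4 * \<epsilon> (Suc k))"
    proof (rule ccontr)
      assume "\<not> ?thesis"
      then have "\<forall>e\<in>K. \<exists>K'. finite K' \<and> K' \<subseteq> ?S \<inter> mball e (4 * \<epsilon> k) \<and>
          ?S \<inter> mball e (4 * \<epsilon> k) \<subseteq> (\<Union>x\<in>K'. mball x (4 * \<epsilon> (Suc k)))"
        unfolding finitely_coverable_def by blast
      then obtain f where f: "\<And>e. e \<in> K \<Longrightarrow> finite (f e)"
          "\<And>e. e \<in> K \<Longrightarrow> f e \<subseteq> ?S"
          "\<And>e. e \<in> K \<Longrightarrow> ?S \<inter> mball e (4 * \<epsilon> k) \<subseteq> (\<Union>x\<in>f e. mball x (4 * \<epsilon> (Suc k)))"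
        using bchoice[of K] by (metis Int_subset_iff)
      have "?S \<subseteq> (\<Union>e\<in>K. ?S \<inter> mball e (4 * \<epsilon> k))" using K(3) by blast
      also have "\<dots> \<subseteq> (\<Union>e\<in>K. \<Union>x\<in>f e. mball x (4 * \<epsilon> (Suc k)))"
        using f(3) by (intro UN_mono) auto
      also have "\<dots> = (\<Union>x\<in>(\<Union>e\<in>K. f e). mball x (4 * \<epsilon> (Suc k)))" by blast
      finally have "finitely_coverable ?S (4 * \<epsilon> (Suc k))"
        unfolding finitely_coverable_def
        using f(1,2) K(1) by (intro exI[of _ "\<Union>e\<in>K. f e"]) (simp add: UN_least)
      then show False using k by blast
    qed
    then obtain e where e: "e \<in> ?S"
      and wide: "\<not> finitely_coverable (?S \<inter> mball e (4 * \<epsilon> k)) (4 * \<epsilon> (Suc k))"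
      using K(2) by blast
    have ec: "e \<in> carrier G" using e by simp
    obtain z where z: "z \<in> carrier G" "d b z \<le> 2 * \<rho> m" "\<And>j. m \<le> j \<Longrightarrow> 7 * \<epsilon> j \<le> d z (q j)"
      using avoiding_point[OF bc, of m] by blast
    have u: "z \<otimes> e \<in> carrier G" using z ec by simp
    have "mball (z \<otimes> e) (\<epsilon> k) \<subseteq> mtopology closure_of ((avoiding \<inter> mball b r) <#> E)"
    proof (rule ball_subset_closure_avoiding_mult[OF bc r \<tau>(1) E u])
      fix y n assume y: "y \<in> mball (z \<otimes> e) (\<epsilon> k)"
      then have yc: "y \<in> carrier G" by simp
      have "?S \<inter> mball e (4 * \<epsilon> k) \<subseteq> carrier G" "4 * \<epsilon> (Suc k) > 0"
        using \<epsilon>_pos[of "Suc k"] by auto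
      from large_separated_subset[OF this wide, of "Suc n"]
      obtain T where T: "T \<subseteq> ?S \<inter> mball e (4 * \<epsilon> k)" "finite T" "card T = Suc n"
        "\<forall>x\<in>T. \<forall>y\<in>T. x \<noteq> y \<longrightarrow> 4 * \<epsilon> (Suc k) \<le> d x y"
        by (elim exE conjE) (rule that)
      have Tc: "T \<subseteq> carrier G" using T(1) by auto
      \<comment> \<open>Two candidates ruled out by the same \<open>j\<close> would be closer than \<open>4 * \<epsilon> j\<close>, and there are more than \<open>n\<close>
        candidates for at most \<open>n\<close> indices.\<close>
      have "\<exists>e'\<in>T. \<forall>j<n. k < j \<longrightarrow> 2 * \<epsilon> j \<le> d (y \<otimes> inv e') (q j)"
      proof (rule ccontr)
        assume "\<not> ?thesis"
        then have "\<forall>e'\<in>T. \<exists>j. j < n \<and> k < j \<and> d (y \<otimes> inv e') (q j) < 2 * \<epsilon> j"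
          by (meson not_le)
        then obtain f where f: "\<And>e'. e' \<in> T \<Longrightarrow> f e' < n \<and> k < f e' \<and>
            d (y \<otimes> inv e') (q (f e')) < 2 * \<epsilon> (f e')"
          by metis
        have "inj_on f T"
        proof (rule inj_onI, rule ccontr)
          fix p p' assume p: "p \<in> T" "p' \<in> T" "f p = f p'" "p \<noteq> p'"
          then have pc: "p \<in> carrier G" "p' \<in> carrier G" using Tc by auto
          have "d p p' = d (y \<otimes> inv p) (y \<otimes> inv p')"
            using yc pc by (simp add: dist_right_quotient)
          also have "\<dots> \<le> d (y \<otimes> inv p) (q (f p)) + d (q (f p)) (y \<otimes> inv p')"
            using triangle yc pc q_carrier by simp
          also have "\<dots> < 4 * \<epsilon> (f p)"
            using f[OF p(1)] f[OF p(2)] p(3) by (simp add: commute)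
          also have "\<dots> \<le> 4 * \<epsilon> (Suc k)"
            using f[OF p(1)] \<epsilon>_decreasing[of "Suc k" "f p"] by simp
          finally show False using T(4) p by fastforce
        qed
        moreover have "f ` T \<subseteq> {..<n}" using f by auto
        ultimately have "card T \<le> n" using card_inj_on_le[of f T "{..<n}"] by simp
        then show False using T(3) by simp
      qed
      then obtain e' where e': "e' \<in> T"
        and late: "\<And>j. \<lbrakk>j < n; k < j\<rbrakk> \<Longrightarrow> 2 * \<epsilon> j \<le> d (y \<otimes> inv e') (q j)" by blast
      have e'E: "e' \<in> E" and e'c: "e' \<in> carrier G" and ee': "d e e' < 4 * \<epsilon> k"
        using e' T(1) by auto
      define v where "v = y \<otimes> inv e'"
      have vc: "v \<in> carrier G" using yc e'c by (simp add: v_def)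
      have "d y (z \<otimes> e') \<le> d y (z \<otimes> e) + d (z \<otimes> e) (z \<otimes> e')"
        using triangle yc z(1) ec e'c by simp
      then have vz: "d v z < 5 * \<epsilon> k"
        using y ee' left_invariant[OF ec e'c z(1)] dist_mult_inv[OF yc e'c z(1)]
        by (simp add: v_def commute)
      have \<epsilon>k: "5 * \<epsilon> k \<le> \<rho> m"
        using \<epsilon>_decreasing[OF k(1)] \<epsilon>_\<rho>[of m] \<epsilon>_pos[of m] by linarith
      have vb: "d v b \<le> 3 * \<rho> m"
        using triangle[of v z b] vc z(1,2) bc vz \<epsilon>k by (simp add: commute)
      have "\<tau> * \<epsilon> j \<le> d v (q j)" if "j < n" for j
      proof -
        consider "k < j" | "m \<le> j" "j \<le> k" | "j < m" by linarith
        then show ?thesis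
        proof cases
          case 1
          have "\<tau> * \<epsilon> j \<le> 2 * \<epsilon> j" using \<epsilon>_pos[of j] \<tau> by (intro mult_right_mono) auto
          then show ?thesis using late[OF that 1] by (simp add: v_def)
        next
          case 2
          have "\<tau> * \<epsilon> j \<le> 2 * \<epsilon> j" using \<epsilon>_pos[of j] \<tau> by (intro mult_right_mono) auto
          moreover have "d z (q j) \<le> d v z + d v (q j)"
            using triangle[of z v "q j"] vc z(1) q_carrier by (simp add: commute)
          ultimately show ?thesis
            using z(3)[OF 2(1)] vz \<epsilon>_decreasing[OF 2(2)] by linarith
        next
          case 3
          have "\<tau> * \<epsilon> j \<le> (\<sigma> + 1) / 2 * \<epsilon> j" "\<gamma> * \<epsilon> j \<le> (\<sigma> - 1) / 6 * \<epsilon> j"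
            using mult_right_mono[OF \<tau>_le less_imp_le[OF \<epsilon>_pos]]
              mult_right_mono[OF \<gamma>(3) less_imp_le[OF \<epsilon>_pos]] by blast+
          moreover have "d b (q j) \<le> d b v + d v (q j)"
            using triangle vc bc q_carrier by blast
          ultimately show ?thesis
            using \<sigma>(2)[of j] vb m(2)[OF 3] by (simp add: commute field_simps)
        qed
      qed
      moreover have "d v b \<le> r / 2" using vb m(1) \<gamma> by linarith
      ultimately show "\<exists>e\<in>E. d (y \<otimes> inv e) b \<le> r / 2 \<and> (\<forall>j<n. \<tau> * \<epsilon> j \<le> d (y \<otimes> inv e) (q j))"
        using e'E by (auto simp: v_def)
    qed
    then show False
      using ball_subset_closure_not_nowhere_dense[OF u \<epsilon>_pos] nwd by blast
  qed
  then show ?thesis using \<epsilon>_pos[of m] by (intro exI[of _ "4 * \<epsilon> m"]) auto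
qed

section \<open>The covering \<open>\<sigma>\<close>-compact set\<close>

text \<open>
  The sets \<open>E V Z\<close> collect the \<open>x\<close> with \<open>(V \<inter> avoiding) x\<close> inside the closure of \<open>Z\<close>. Baire's theorem is
  applied in the closure of \<open>avoiding\<close>, since \<open>avoiding\<close> itself is not closed; but an open set that meets
  the closure meets \<open>avoiding\<close>, and the two smallness lemmas start from a point of \<open>avoiding\<close>.
\<close>

lemma cover_by_sigma_compact:
  assumes X: "X \<subseteq> carrier G"
    and meager: "meager_in mtopology ((mtopology closure_of avoiding) <#> X)"
    and P: "P \<subseteq> carrier G" "\<And>n. L n \<subseteq> P"
    and L_dense: "\<And>W. \<lbrakk>openin mtopology W; W \<inter> P \<noteq> {}\<rbrakk> \<Longrightarrow> \<exists>n. L n \<inter> W \<noteq> {}"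
  shows "\<exists>F. sigma_compact_in mtopology F \<and> X \<subseteq> F \<and>
    (\<forall>x\<in>carrier G. meager_in (subtopology mtopology P) (P \<inter> (x <# F)))"
proof -
  define A where "A = mtopology closure_of avoiding"
  have A: "closedin mtopology A" "A \<subseteq> carrier G" "avoiding \<subseteq> A"
    using avoiding_carrier closure_of_subset[of avoiding mtopology] closure_of_subset_topspace[of mtopology]
    by (auto simp: A_def)
  obtain \<N> where \<N>': "countable \<N>" "\<N> \<subseteq> Collect (nowhere_dense_in mtopology)" "\<Union>\<N> = A <#> X"
    using meager unfolding meager_in_def union_of_def A_def[symmetric] by (elim exE conjE) (rule that)
  then have \<N>: "countable \<N>" "\<And>Z. Z \<in> \<N> \<Longrightarrow> nowhere_dense_in mtopology Z" "\<Union>\<N> = A <#> X"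
    by auto
  define \<V> where "\<V> = {V \<in> range (\<lambda>(i, k). mball (q i) (1 / Suc k)). V \<inter> avoiding \<noteq> {}}"
  have \<V>: "countable \<V>" unfolding \<V>_def by (rule countable_subset[of _ "range (\<lambda>(i, k). mball (q i) (1 / Suc k))"]) auto
  define E where "E V Z = {x \<in> carrier G. \<forall>z \<in> V \<inter> avoiding. z \<otimes> x \<in> mtopology closure_of Z}" for V Z
  have E_carrier: "E V Z \<subseteq> carrier G" for V Z by (auto simp: E_def)
  have E_closed: "closedin mtopology (E V Z)" for V Z
  proof -
    have "E V Z = \<Inter>(insert (carrier G)
        ((\<lambda>z. {x \<in> topspace mtopology. z \<otimes> x \<in> mtopology closure_of Z}) ` (V \<inter> avoiding)))"
      by (auto simp: E_def)
    also have "closedin mtopology \<dots>"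
    proof (rule closedin_Inter)
      fix S assume "S \<in> insert (carrier G)
        ((\<lambda>z. {x \<in> topspace mtopology. z \<otimes> x \<in> mtopology closure_of Z}) ` (V \<inter> avoiding))"
      then consider "S = carrier G"
        | z where "z \<in> avoiding" "S = {x \<in> topspace mtopology. z \<otimes> x \<in> mtopology closure_of Z}"
        by blast
      then show "closedin mtopology S"
      proof cases
        case 2
        then show ?thesis
          using closedin_continuous_map_preimage[OF continuous_map_left_mult closedin_closure_of]
            avoiding_carrier by (metis (no_types, lifting) subsetD)
      qed auto
    qed simp
    finally show ?thesis .
  qed
  have E_small: "\<exists>b r. b \<in> avoiding \<and> r > 0 \<and> nowhere_dense_in mtopology ((avoiding \<inter> mball b r) <#> E V Z)"
    if V: "V \<in> \<V>" and Z: "Z \<in> \<N>" for V Z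
  proof -
    obtain b where b: "b \<in> V" "b \<in> avoiding" using V by (auto simp: \<V>_def)
    moreover have "openin mtopology V" using V by (auto simp: \<V>_def)
    ultimately obtain r where r: "r > 0" "mball b r \<subseteq> V" by (meson openin_mtopology)
    have "(avoiding \<inter> mball b r) <#> E V Z \<subseteq> mtopology closure_of Z"
      using r(2) by (auto simp: set_mult_def E_def)
    then show ?thesis using nowhere_dense_in_subset[OF \<N>(2)[OF Z]] b r by blast
  qed
  have E_sigma_compact: "sigma_compact_in mtopology (E V Z)" if VZ: "V \<in> \<V>" "Z \<in> \<N>" for V Z
  proof -
    obtain \<delta> where \<delta>: "\<delta> > 0" "\<And>e. e \<in> E V Z \<Longrightarrow> mtotally_bounded (E V Z \<inter> mball e \<delta>)"
      using E_small[OF VZ] uniformly_locally_totally_bounded[OF _ _ E_carrier] by meson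
    have "compactin mtopology (E V Z \<inter> mcball (q i) (\<delta>/3))" (is "compactin _ ?K") for i
    proof -
      have "mtotally_bounded ?K"
      proof (cases "?K = {}")
        case False
        then obtain e where e: "e \<in> ?K" by blast
        have "mcball (q i) (\<delta>/3) \<subseteq> mball e \<delta>"
          using e \<delta>(1) by (intro mcball_subset_mball) auto
        then show ?thesis
          using mtotally_bounded_subset[OF \<delta>(2)[of e]] e by blast
      qed auto
      moreover have "closedin mtopology ?K" using E_closed by (simp add: closedin_Int)
      ultimately show ?thesis
        using mtotally_bounded_eq_compact_closure_of[OF complete] by (metis closure_of_closedin)
    qed
    moreover have "\<Union>(range (\<lambda>i. E V Z \<inter> mcball (q i) (\<delta>/3))) = E V Z"
    proof -
      have "\<exists>i. e \<in> mcball (q i) (\<delta>/3)" if "e \<in> E V Z" for e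
      proof -
        have e: "e \<in> carrier G" using that E_carrier by blast
        then obtain i where "d e (q i) < \<delta>/3" using q_dense[OF e, of "\<delta>/3"] \<delta>(1) by auto
        then show ?thesis using e q_carrier by (auto simp: commute intro!: exI[of _ i])
      qed
      then show ?thesis by blast
    qed
    ultimately show ?thesis
      unfolding sigma_compact_in_def union_of_def
      by (intro exI[of _ "range (\<lambda>i. E V Z \<inter> mcball (q i) (\<delta>/3))"]) auto
  qed
  have E_meager: "nowhere_dense_in (subtopology mtopology P) (P \<inter> (x <# E V Z))"
    if VZ: "V \<in> \<V>" "Z \<in> \<N>" and x: "x \<in> carrier G" for V Z x
  proof -
    have "x <# E V Z = {y \<in> topspace mtopology. inv x \<otimes> y \<in> E V Z}"
    proof
      show "x <# E V Z \<subseteq> {y \<in> topspace mtopology. inv x \<otimes> y \<in> E V Z}"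
        using x E_carrier[of V Z] by (auto simp: l_coset_def m_assoc[symmetric] subset_iff)
      show "{y \<in> topspace mtopology. inv x \<otimes> y \<in> E V Z} \<subseteq> x <# E V Z"
      proof clarify
        fix y assume "y \<in> topspace mtopology" "inv x \<otimes> y \<in> E V Z"
        moreover from this have "y = x \<otimes> (inv x \<otimes> y)" using x by (simp add: m_assoc[symmetric])
        ultimately show "y \<in> x <# E V Z" unfolding l_coset_def by blast
      qed
    qed
    then have "closedin mtopology (x <# E V Z)"
      using closedin_continuous_map_preimage[OF continuous_map_left_mult[OF inv_closed[OF x]] E_closed] by simp
    then have closed: "closedin (subtopology mtopology P) (P \<inter> (x <# E V Z))"
      by (metis closedin_subtopology Int_commute)
    have "(subtopology mtopology P) interior_of (P \<inter> (x <# E V Z)) = {}"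
    proof (rule ccontr)
      assume "\<not> ?thesis"
      then obtain W where W: "openin mtopology W" "W \<inter> P \<noteq> {}" "W \<inter> P \<subseteq> P \<inter> (x <# E V Z)"
        by (rule interior_of_subtopology_nonempty)
      obtain n c where c: "c \<in> L n" "c \<in> W" using L_dense[OF W(1,2)] by blast
      obtain t where t: "t > 0" "mball c t \<subseteq> W" using W(1) c(2) by (meson openin_mtopology)
      obtain b r where br: "b \<in> avoiding" "r > 0"
        "nowhere_dense_in mtopology ((avoiding \<inter> mball b r) <#> E V Z)"
        using E_small[OF VZ] by blast
      from branches_escape_translate[OF br(1,2) E_carrier br(3) x c(1) t(1)]
      obtain c' n' where c': "c' \<in> L n'" "d c c' < t" "c' \<notin> x <# E V Z"
        by (elim bexE UN_E conjE) (rule that)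
      have "c' \<in> mball c t" using c c' L_carrier by (meson in_mball subsetD)
      then show False using t(2) W(3) c'(1,3) P(2) by blast
    qed
    then show ?thesis
      using closed closure_of_closedin[OF closed] closedin_subset[OF closed]
      unfolding nowhere_dense_in_def by simp
  qed
  have covered: "\<exists>V\<in>\<V>. \<exists>Z\<in>\<N>. x \<in> E V Z" if x: "x \<in> X" for x
  proof -
    have xc: "x \<in> carrier G" using x X by blast
    define C where "C Z = A \<inter> {z \<in> topspace mtopology. z \<otimes> x \<in> mtopology closure_of Z}" for Z
    have C_closed: "closedin (subtopology mtopology A) (C Z)" for Z
      unfolding C_def
      using closedin_continuous_map_preimage[OF continuous_map_right_mult[OF xc] closedin_closure_of]
      by (metis (no_types, lifting) closedin_subtopology Int_commute)
    have "A \<subseteq> \<Union>(C ` \<N>)"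
    proof
      fix z assume z: "z \<in> A"
      then have "z \<otimes> x \<in> \<Union>\<N>" using x unfolding \<N>(3) set_mult_def by blast
      then obtain Z where Z: "Z \<in> \<N>" "z \<otimes> x \<in> Z" by blast
      then have "z \<otimes> x \<in> mtopology closure_of Z"
        using \<N>(2)[OF Z(1)] closure_of_subset[of Z mtopology] by (auto simp: nowhere_dense_in_def)
      then show "z \<in> \<Union>(C ` \<N>)" using z A(2) Z(1) by (auto simp: C_def)
    qed
    moreover have "\<Union>(C ` \<N>) \<subseteq> A" by (auto simp: C_def)
    ultimately have CA: "\<Union>(C ` \<N>) = topspace (subtopology mtopology A)" using A(2) by auto
    have "A \<noteq> {}" using A(3) avoiding_nonempty by blast
    then have "(subtopology mtopology A) interior_of \<Union>(C ` \<N>) \<noteq> {}"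
      unfolding CA interior_of_topspace using A(2) by auto
    moreover have "completely_metrizable_space (subtopology mtopology A)"
      using completely_metrizable_space_closedin completely_metrizable_space_mtopology complete A(1) by blast
    ultimately have "\<exists>Z\<in>\<N>. (subtopology mtopology A) interior_of (C Z) \<noteq> {}"
      using Baire_category_alt[of "subtopology mtopology A" "C ` \<N>"] C_closed \<N>(1)
      by (metis (no_types, lifting) countable_image imageE)
    then obtain Z where Z: "Z \<in> \<N>" "(subtopology mtopology A) interior_of (C Z) \<noteq> {}"
      by blast
    from Z(2) obtain W where W: "openin mtopology W" "W \<inter> A \<noteq> {}" "W \<inter> A \<subseteq> C Z"
      by (rule interior_of_subtopology_nonempty)
    then have "W \<inter> avoiding \<noteq> {}"
      by (simp add: A_def openin_Int_closure_of_eq_empty)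
    then obtain b where b: "b \<in> W" "b \<in> avoiding" by blast
    obtain i k where ik: "b \<in> mball (q i) (1 / Suc k)" "mball (q i) (1 / Suc k) \<subseteq> W"
      using small_rational_ball[of q W b] q_carrier q_dense W(1) b(1) by blast
    have "mball (q i) (1 / Suc k) \<in> \<V>"
      using ik(1) b(2) unfolding \<V>_def by blast
    moreover have "x \<in> E (mball (q i) (1 / Suc k)) Z"
      using xc ik(2) W(3) A(3) unfolding E_def C_def by blast
    ultimately show ?thesis using Z(1) by blast
  qed
  define \<E> where "\<E> = (\<lambda>(V, Z). E V Z) ` (\<V> \<times> \<N>)"
  have \<E>: "countable \<E>" using \<V> \<N>(1) by (simp add: \<E>_def)
  have "sigma_compact_in mtopology (\<Union>\<E>)"
    unfolding sigma_compact_in_def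
    by (rule countable_union_of_Union[OF \<E>])
      (use E_sigma_compact in \<open>auto simp: \<E>_def sigma_compact_in_def\<close>)
  moreover have "X \<subseteq> \<Union>\<E>" using covered unfolding \<E>_def by fast
  moreover have "meager_in (subtopology mtopology P) (P \<inter> (x <# \<Union>\<E>))" if "x \<in> carrier G" for x
    unfolding meager_in_def union_of_def
  proof (intro exI conjI)
    show "countable ((\<lambda>S. P \<inter> (x <# S)) ` \<E>)" using \<E> by simp
    show "(\<lambda>S. P \<inter> (x <# S)) ` \<E> \<subseteq> Collect (nowhere_dense_in (subtopology mtopology P))"
      using E_meager that by (auto simp: \<E>_def)
    show "\<Union>((\<lambda>S. P \<inter> (x <# S)) ` \<E>) = P \<inter> (x <# \<Union>\<E>)"
      by (auto simp: l_coset_def)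
  qed
  ultimately show ?thesis by blast
qed

end

section \<open>Existence of branching scales and the case of isolated points\<close>

context bi_invariant_group
begin

lemma finite_branching_scale:
  assumes "finite L" "L \<subseteq> P" "\<rho> > 0"
    and perfect: "\<And>c s. \<lbrakk>c \<in> P; s > 0\<rbrakk> \<Longrightarrow> \<exists>c'\<in>P. 0 < d c c' \<and> d c c' < s"
  shows "\<exists>\<epsilon>>0. 16 * \<epsilon> \<le> \<rho> \<and> (\<forall>c\<in>L. \<exists>c'\<in>P. 16 * \<epsilon> \<le> d c c' \<and> d c c' \<le> \<rho>)"
proof -
  have "\<forall>c\<in>L. \<exists>c'. c' \<in> P \<and> 0 < d c c' \<and> d c c' < \<rho>"
    using assms by blast
  then obtain f where f: "\<And>c. c \<in> L \<Longrightarrow> f c \<in> P \<and> 0 < d c (f c) \<and> d c (f c) < \<rho>"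
    by metis
  define \<epsilon> where "\<epsilon> = Min (insert \<rho> ((\<lambda>c. d c (f c)) ` L)) / 16"
  have "\<epsilon> > 0" using assms(1,3) f by (simp add: \<epsilon>_def)
  moreover have "16 * \<epsilon> \<le> \<rho>" using assms(1) by (simp add: \<epsilon>_def)
  moreover have "16 * \<epsilon> \<le> d c (f c)" if "c \<in> L" for c
    using assms(1) that by (simp add: \<epsilon>_def)
  ultimately show ?thesis using f by (meson less_imp_le)
qed

text \<open>
  The sequence \<open>p\<close> is fed into the sets \<open>L n\<close> one term at a time; a sequence dense in \<open>P\<close> makes their union
  dense in \<open>P\<close>.
\<close>

lemma branching_scales_exist:
  assumes complete: mcomplete
    and q: "\<And>n. q n \<in> carrier G" "\<And>y r. \<lbrakk>y \<in> carrier G; r > 0\<rbrakk> \<Longrightarrow> \<exists>i. d y (q i) < r"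
    and P: "P \<subseteq> carrier G" "\<And>n. p n \<in> P"
    and perfect: "\<And>c s. \<lbrakk>c \<in> P; s > 0\<rbrakk> \<Longrightarrow> \<exists>c'\<in>P. 0 < d c c' \<and> d c c' < s"
  shows "\<exists>L \<epsilon> \<rho>. branching_scales G d L \<epsilon> \<rho> q \<and> (\<forall>n. L n \<subseteq> P \<and> p n \<in> L n)"
proof -
  define I where "I n s \<longleftrightarrow> (case s of (L, \<epsilon>, \<rho>) \<Rightarrow> finite L \<and> L \<subseteq> P \<and> p n \<in> L \<and> 0 < \<epsilon> \<and> 16 * \<epsilon> \<le> \<rho> \<and>
    (\<forall>c\<in>L. \<exists>c'\<in>P. 16 * \<epsilon> \<le> d c c' \<and> d c c' \<le> \<rho>))" for n :: nat and s :: "'a set \<times> real \<times> real"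
  define J where "J n s s' \<longleftrightarrow> (case s of (L, \<epsilon>, \<rho>) \<Rightarrow> case s' of (L', \<epsilon>', \<rho>') \<Rightarrow>
    L \<subseteq> L' \<and> (\<forall>c\<in>L. \<exists>c'\<in>L'. 16 * \<epsilon> \<le> d c c' \<and> d c c' \<le> \<rho>) \<and> 2 ^ Suc n * \<rho>' \<le> \<epsilon>)"
    for n :: nat and s s' :: "'a set \<times> real \<times> real"
  have "\<exists>f. \<forall>n. I n (f n) \<and> J n (f n) (f (Suc n))"
  proof (rule dependent_nat_choice)
    obtain \<epsilon> where "\<epsilon> > 0" "16 * \<epsilon> \<le> 1" "\<forall>c\<in>{p 0}. \<exists>c'\<in>P. 16 * \<epsilon> \<le> d c c' \<and> d c c' \<le> 1"
      using finite_branching_scale[of "{p 0}" P 1, OF _ _ _ perfect] P(2) by auto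
    then have "I 0 ({p 0}, \<epsilon>, 1)" using P(2) by (simp add: I_def)
    then show "\<exists>s. I 0 s" by blast
  next
    fix s n assume I: "I n s"
    obtain L \<epsilon> \<rho> where s: "s = (L, \<epsilon>, \<rho>)" by (cases s) auto
    have L: "finite L" "L \<subseteq> P" "0 < \<epsilon>" "\<forall>c\<in>L. \<exists>c'\<in>P. 16 * \<epsilon> \<le> d c c' \<and> d c c' \<le> \<rho>"
      using I by (simp_all add: I_def s)
    then obtain f where f: "\<And>c. c \<in> L \<Longrightarrow> f c \<in> P \<and> 16 * \<epsilon> \<le> d c (f c) \<and> d c (f c) \<le> \<rho>"
      by metis
    define L' where "L' = insert (p (Suc n)) (L \<union> f ` L)"
    define \<rho>' where "\<rho>' = \<epsilon> / 2 ^ Suc n"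
    have L': "finite L'" "L' \<subseteq> P" "\<rho>' > 0"
      using L(1,2,3) f P(2) by (auto simp: L'_def \<rho>'_def)
    then obtain \<epsilon>' where \<epsilon>': "\<epsilon>' > 0" "16 * \<epsilon>' \<le> \<rho>'"
      "\<forall>c\<in>L'. \<exists>c'\<in>P. 16 * \<epsilon>' \<le> d c c' \<and> d c c' \<le> \<rho>'"
      using finite_branching_scale[OF L' perfect] by blast
    have "I (Suc n) (L', \<epsilon>', \<rho>')"
      using L' \<epsilon>' by (simp add: I_def) (simp add: L'_def)
    moreover have "\<forall>c\<in>L. \<exists>c'\<in>L'. 16 * \<epsilon> \<le> d c c' \<and> d c c' \<le> \<rho>"
      using f unfolding L'_def by blast
    then have "J n s (L', \<epsilon>', \<rho>')"
      unfolding J_def s by (auto simp: L'_def \<rho>'_def)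
    ultimately show "\<exists>s'. I (Suc n) s' \<and> J n s s'" by blast
  qed
  then obtain f where f: "\<And>n. I n (f n)" "\<And>n. J n (f n) (f (Suc n))" by blast
  define L where "L n = fst (f n)" for n
  define \<epsilon> where "\<epsilon> n = fst (snd (f n))" for n
  define \<rho> where "\<rho> n = snd (snd (f n))" for n
  have fn: "f n = (L n, \<epsilon> n, \<rho> n)" for n by (simp add: L_def \<epsilon>_def \<rho>_def)
  have I: "L n \<subseteq> P" "p n \<in> L n" "0 < \<epsilon> n" "16 * \<epsilon> n \<le> \<rho> n" for n
    using f(1)[of n] by (simp_all add: fn I_def)
  have J: "L n \<subseteq> L (Suc n)" "\<forall>c\<in>L n. \<exists>c'\<in>L (Suc n). 16 * \<epsilon> n \<le> d c c' \<and> d c c' \<le> \<rho> n"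
      "2 ^ Suc n * \<rho> (Suc n) \<le> \<epsilon> n" for n
    using f(2)[of n] by (simp_all add: fn J_def)
  have "branching_scales G d L \<epsilon> \<rho> q"
  proof
    show mcomplete by (rule complete)
    show "L n \<subseteq> carrier G" "L n \<noteq> {}" for n using I(1,2)[of n] P(1) by auto
    show "L n \<subseteq> L (Suc n)" "2 ^ Suc n * \<rho> (Suc n) \<le> \<epsilon> n" for n by (rule J)+
    show "\<exists>c'\<in>L (Suc n). 16 * \<epsilon> n \<le> d c c' \<and> d c c' \<le> \<rho> n" if "c \<in> L n" for c n
      using J(2)[of n] that by (rule bspec)
    show "\<epsilon> n > 0" "16 * \<epsilon> n \<le> \<rho> n" for n by (rule I)+
    show "q n \<in> carrier G" for n by (rule q)
    show "\<exists>i. d y (q i) < r" if "y \<in> carrier G" "r > 0" for y r using that by (rule q)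
  qed
  then show ?thesis using I by blast
qed

lemma cover_for_nonempty_perfect:
  fixes q :: "nat \<Rightarrow> 'a"
  assumes complete: mcomplete
    and q: "\<And>n. q n \<in> carrier G" "\<And>y r. \<lbrakk>y \<in> carrier G; r > 0\<rbrakk> \<Longrightarrow> \<exists>i. d y (q i) < r"
    and X: "meager_additive G mtopology X"
    and P: "perfect_in mtopology P" "P \<noteq> {}"
  shows "\<exists>F. sigma_compact_in mtopology F \<and> X \<subseteq> F \<and>
    (\<forall>x\<in>carrier G. meager_in (subtopology mtopology P) (P \<inter> (x <# F)))"
proof -
  have Pc: "P \<subseteq> carrier G" using P(1) closedin_subset unfolding perfect_in_def by fastforce
  have perfect: "\<exists>c'\<in>P. 0 < d c c' \<and> d c c' < s" if c: "c \<in> P" "s > 0" for c s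
  proof -
    have "c \<in> mtopology derived_set_of P" using P(1) c(1) unfolding perfect_in_def by blast
    then obtain c' where c': "c' \<in> P" "c' \<noteq> c" "c' \<in> mball c s"
      using c(2) unfolding metric_derived_set_of by blast
    then have "0 < d c c'" using c(1) Pc by (metis in_mball mdist_pos_less)
    moreover have "d c c' < s" using c'(3) by simp
    ultimately show ?thesis using c'(1) by blast
  qed
  \<comment> \<open>A dense sequence in \<open>P\<close>: one point from each nonempty trace of a basic ball.\<close>
  define B where "B n = (case prod_decode n of (i, k) \<Rightarrow> mball (q i) (1 / real (Suc k)))" for n
  define p where "p n = (if P \<inter> B n \<noteq> {} then SOME c. c \<in> P \<inter> B n else SOME c. c \<in> P)" for n
  have p: "p n \<in> P" "P \<inter> B n \<noteq> {} \<Longrightarrow> p n \<in> B n" for n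
    using someI_ex[of "\<lambda>c. c \<in> P \<inter> B n"] someI_ex[of "\<lambda>c. c \<in> P"] P(2)
    by (auto simp: p_def)
  obtain L \<epsilon> \<rho> where L: "branching_scales G d L \<epsilon> \<rho> q" "\<And>n. L n \<subseteq> P" "\<And>n. p n \<in> L n"
    using branching_scales_exist[where p = p, OF complete q Pc p(1) perfect] by blast
  interpret branching_scales G d L \<epsilon> \<rho> q by (rule L)
  have "\<exists>n. L n \<inter> W \<noteq> {}" if W: "openin mtopology W" "W \<inter> P \<noteq> {}" for W
  proof -
    obtain b where b: "b \<in> W" "b \<in> P" using W(2) by blast
    obtain i k where ik: "b \<in> mball (q i) (1 / Suc k)" "mball (q i) (1 / Suc k) \<subseteq> W"
      using small_rational_ball[of q W b] q W(1) b(1) by blast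
    have "B (prod_encode (i, k)) = mball (q i) (1 / Suc k)" by (simp add: B_def)
    then have "p (prod_encode (i, k)) \<in> W" using p(2)[of "prod_encode (i, k)"] ik b by blast
    then show ?thesis using L(3) by blast
  qed
  moreover have "nowhere_dense_in mtopology (mtopology closure_of avoiding)"
    using nowhere_dense_in_subset[OF avoiding_nowhere_dense] by blast
  then have "meager_in mtopology (mtopology closure_of avoiding)"
    unfolding meager_in_def by (simp add: countable_union_of_inc)
  then have "meager_in mtopology ((mtopology closure_of avoiding) <#> X)"
    using X unfolding meager_additive_def by blast
  ultimately show ?thesis
    using cover_by_sigma_compact[OF _ _ Pc L(2)] X unfolding meager_additive_def by blast
qed

text \<open>
  By invariance all points are isolated with the same radius, so a dense sequence exhausts the group.
\<close>

lemma isolated_point_countable: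
  fixes q :: "nat \<Rightarrow> 'a"
  assumes q: "\<And>n. q n \<in> carrier G" "\<And>y r. \<lbrakk>y \<in> carrier G; r > 0\<rbrakk> \<Longrightarrow> \<exists>i. d y (q i) < r"
    and "\<not> perfect_in mtopology (carrier G)"
  shows "countable (carrier G)"
proof -
  obtain c where c: "c \<in> carrier G" "c \<notin> mtopology derived_set_of (carrier G)"
    using assms(3) unfolding perfect_in_def by auto
  then obtain r where r: "r > 0" "\<And>y. \<lbrakk>y \<in> carrier G; y \<noteq> c\<rbrakk> \<Longrightarrow> r \<le> d c y"
    unfolding metric_derived_set_of by (auto simp: not_less)
  have "y \<in> range q" if y: "y \<in> carrier G" for y
  proof -
    obtain i where i: "d y (q i) < r" using q(2)[OF y r(1)] by blast
    have "d y (q i) = d c (c \<otimes> (inv y \<otimes> q i))"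
      using left_invariant[OF y q(1), of "c \<otimes> inv y" i] c y q(1)[of i] by (simp add: m_assoc)
    then have "c \<otimes> (inv y \<otimes> q i) = c"
      using i r(2)[of "c \<otimes> (inv y \<otimes> q i)"] c y q(1)[of i] by fastforce
    then have "d y (q i) = 0"
      using \<open>d y (q i) = _\<close> c(1) by simp
    then show ?thesis using y q(1)[of i] by (metis rangeI zero)
  qed
  then have "carrier G \<subseteq> range q" by blast
  then show ?thesis by (rule countable_subset) simp
qed

end

theorem proposition6p6:
  fixes G :: "('a, 'b) monoid_scheme" and T :: "'a topology" and X :: "'a set"
  assumes "Polish_group G T"
    and "\<exists>d. invariant_metric G T d"
    and "meager_additive G T X"
  shows "transitively_meager G T X"
proof -
  interpret PG: Polish_group G T by (rule assms)
  obtain d where d: "Metric_space (carrier G) d" "Metric_space.mtopology (carrier G) d = T"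
    and inv: "\<And>x y z. \<lbrakk>x \<in> carrier G; y \<in> carrier G; z \<in> carrier G\<rbrakk> \<Longrightarrow>
      d (z \<otimes>\<^bsub>G\<^esub> x) (z \<otimes>\<^bsub>G\<^esub> y) = d x y \<and> d (x \<otimes>\<^bsub>G\<^esub> z) (y \<otimes>\<^bsub>G\<^esub> z) = d x y"
    using assms(2) unfolding invariant_metric_def by blast
  interpret Metric_space "carrier G" d by (rule d)
  interpret bi_invariant_group G d by unfold_locales (use inv in blast)+
  have T: "mtopology = T" by (rule d)
  have complete: mcomplete
    using mcomplete_if_completely_metrizable PG.completely_metrizable by (simp add: T)
  obtain C where C: "countable C" "C \<subseteq> carrier G" "mtopology closure_of C = carrier G"
    using PG.separable unfolding separable_space_def T PG.topspace_eq by blast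
  have "C \<noteq> {}" using C(3) PG.one_closed by auto
  define q where "q = from_nat_into C"
  have range_q: "range q = C" using C(1) \<open>C \<noteq> {}\<close> by (simp add: q_def range_from_nat_into)
  have q: "q n \<in> carrier G" for n using range_q C(2) by blast
  have q_dense: "\<exists>i. d y (q i) < r" if "y \<in> carrier G" "r > 0" for y r
  proof -
    have "\<exists>c\<in>C. c \<in> mball y r" using that C(3) unfolding metric_closure_of by blast
    then obtain c where "c \<in> C" "c \<in> mball y r" by blast
    then show ?thesis using range_q by (metis in_mball rangeE)
  qed
  have cover: "\<exists>F. sigma_compact_in T F \<and> X \<subseteq> F \<and>
      (\<forall>x\<in>carrier G. meager_in (subtopology T P) (P \<inter> (x <#\<^bsub>G\<^esub> F)))"
    if "perfect_in T P" "P \<noteq> {}" for P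
    using cover_for_nonempty_perfect[where q = q, OF complete q q_dense] assms(3) that
    by (simp add: T)
  have empty: "meager_in (subtopology T {}) ({} \<inter> S)" for S
    unfolding meager_in_def by (simp add: union_of_empty)
  have X: "X \<subseteq> carrier G" using assms(3) by (simp add: meager_additive_def)
  have "\<exists>F. sigma_compact_in T F \<and> X \<subseteq> F"
  proof (cases "perfect_in T (carrier G)")
    case True
    then show ?thesis using cover[OF True] by (metis PG.one_closed empty_iff)
  next
    case False
    then have "countable (carrier G)"
      using isolated_point_countable[where q = q, OF q q_dense] by (simp add: T)
    then have "countable ((\<lambda>x. {x}) ` X)" using X by (meson countable_image countable_subset)
    moreover have "(\<lambda>x. {x}) ` X \<subseteq> Collect (compactin T)"
      using X by (auto simp: PG.topspace_eq)
    ultimately have "sigma_compact_in T X"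
      unfolding sigma_compact_in_def union_of_def by (intro exI[of _ "(\<lambda>x. {x}) ` X"]) auto
    then show ?thesis by blast
  qed
  then have "\<exists>F. sigma_compact_in T F \<and> X \<subseteq> F \<and>
      (\<forall>x\<in>carrier G. meager_in (subtopology T P) (P \<inter> (x <#\<^bsub>G\<^esub> F)))" if "P = {}" for P
    using empty that by blast
  then show ?thesis
    using cover X unfolding transitively_meager_def by blast
qed

end
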